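(* For every integer $k\ge 1$, the Bernoulli number $B_k$ is given by $$B_k=k!\sum_{\lambda:\ |\lambda|=k}\frac{G(\lambda)}{(\lambda_1+1)\cdots(\lambda_l+1)},\qquad G(\lambda)=\sum_{\mu:\ |\mu|=k}(-1)^{k-l(\mu)}\,C^\mu_\lambda\,N(\mu),$$ where $\lambda=(\lambda_1,\dots,\lambda_l)$ and $\mu$ run over all partitions of $k$.
   Context: The Bernoulli numbers are defined by $\frac{x}{e^x-1}=\sum_{n\ge0}B_n\frac{x^n}{n!}$. For a partition $\mu$, $l(\mu)$ is its number of parts and $N(\mu)$ is the number of different permutations of its sequence of parts, i.e. $N(\mu)=l(\mu)!/\prod_j m_j(\mu)!$ with $m_j(\mu)$ the number of parts equal to $j$. Let $a_1,a_2,\dots$ be indeterminates and let $b_1,b_2,\dots\in\mathbb Z[a_1,a_2,\dots]$ be defined by requiring that $\beta(v)=v+\sum_{n\ge1}b_nv^{n+1}$ be the compositional inverse of $\alpha(u)=u+\sum_{n\ge1}a_nu^{n+1}$. For a partition $\lambda=(\lambda_1,\dots,\lambda_l)$ put $a^\lambda=a_{\lambda_1}\cdots a_{\lambda_l}$ and $b^\lambda=b_{\lambda_1}\cdots b_{\lambda_l}$. The integers $C^\mu_\lambda$ are defined by $b^\mu=\sum_\lambda C^\mu_\lambda a^\lambda$, the sum being over partitions $\lambda$ of $|\mu|$; that is, $C^\mu_\lambda$ is the coefficient of $a^\lambda$ in $b^\mu$. *)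

theory Defs
  imports
    "HOL-Computational_Algebra.Formal_Power_Series"
    "HOL-Combinatorics.Multiset_Permutations"
    "HOL-Library.Poly_Mapping"
begin

unbundle fps_syntax

definition bernoulli_num :: "nat \<Rightarrow> rat" where
  "bernoulli_num n = fact n * (fps_X / (fps_exp 1 - 1)) $ n"

lemma bernoulli_num_egf:
  "Abs_fps (\<lambda>n. bernoulli_num n / fact n) * (fps_exp 1 - 1) = fps_X"
proof -
  have nth1: "(fps_exp 1 - 1 :: rat fps) $ Suc 0 = 1"
    by simp
  hence nz: "(fps_exp 1 - 1 :: rat fps) \<noteq> 0"
    by (metis fps_zero_nth zero_neq_one)
  have "subdegree (fps_exp 1 - 1 :: rat fps) = 1"
    by (rule subdegreeI) auto
  hence "(fps_exp 1 - 1 :: rat fps) dvd fps_X"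
    using nz by (subst fps_dvd_iff) auto
  moreover have "Abs_fps (\<lambda>n. bernoulli_num n / fact n) = fps_X / (fps_exp 1 - 1)"
    by (rule fps_ext) (simp add: bernoulli_num_def)
  ultimately show ?thesis
    by simp
qed


text \<open>A partition is represented by the multiset of its (positive) parts.\<close>

definition partitions :: "nat \<Rightarrow> nat multiset set" where
  "partitions k = {\<mu>. 0 \<notin># \<mu> \<and> sum_mset \<mu> = k}"

lemma size_le_sum_mset:
  assumes "0 \<notin># (\<mu> :: nat multiset)"
  shows "size \<mu> \<le> sum_mset \<mu>"
  using assms by (induction \<mu>) auto

lemma finite_partitions: "finite (partitions k)"
proof (rule finite_subset)
  show "partitions k \<subseteq> mset ` {xs. set xs \<subseteq> {..k} \<and> length xs \<le> k}"
  proof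
    fix \<mu> assume \<mu>: "\<mu> \<in> partitions k"
    obtain xs where xs: "\<mu> = mset xs"
      by (metis ex_mset)
    have "length xs \<le> k"
      using size_le_sum_mset[of \<mu>] \<mu> by (auto simp: partitions_def xs)
    moreover have "set xs \<subseteq> {..k}"
      using \<mu> member_le_sum_list[of _ xs] by (auto simp: partitions_def xs sum_mset_sum_list)
    ultimately show "\<mu> \<in> mset ` {xs. set xs \<subseteq> {..k} \<and> length xs \<le> k}"
      using xs by blast
  qed
  show "finite (mset ` {xs. set xs \<subseteq> {..k} \<and> length xs \<le> k})"
    by (intro finite_imageI finite_lists_length_le) auto
qed

definition num_perms :: "nat multiset \<Rightarrow> nat" where
  "num_perms \<mu> = card (permutations_of_multiset \<mu>)"

lemma num_perms_altdef:
  "num_perms \<mu> = fact (size \<mu>) div (\<Prod>j\<in>set_mset \<mu>. fact (count \<mu> j))"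
  unfolding num_perms_def by (rule card_permutations_of_multiset)


text \<open>
  The ring of integer polynomials in countably many indeterminates, as the monoid ring of the
  exponent vectors.  Index \<open>0\<close> is included for uniformity only: \<open>indet 0\<close> does not occur
  in \<open>alpha_fps\<close>.
\<close>

type_synonym zpoly = "(nat \<Rightarrow>\<^sub>0 nat) \<Rightarrow>\<^sub>0 int"

definition indet :: "nat \<Rightarrow> zpoly" where
  "indet n = Poly_Mapping.single (Poly_Mapping.single n 1) 1"

definition alpha_fps :: "zpoly fps" where
  "alpha_fps = fps_X + Abs_fps (\<lambda>m. if m \<ge> 2 then indet (m - 1) else 0)"

definition is_comp_inverse :: "'a :: comm_ring_1 fps \<Rightarrow> 'a fps \<Rightarrow> bool" where
  "is_comp_inverse f g \<longleftrightarrow>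
     f $ 0 = 0 \<and> g $ 0 = 0 \<and> f oo g = fps_X \<and> g oo f = fps_X"

definition beta_fps :: "zpoly fps" where
  "beta_fps = (THE g. is_comp_inverse alpha_fps g)"

definition b_coeff :: "nat \<Rightarrow> zpoly" where
  "b_coeff n = beta_fps $ (n + 1)"

text \<open>\<open>fps_inv\<close> of the library is restricted to fields, hence the following.\<close>

fun left_inv_coeff :: "'a :: comm_ring_1 fps \<Rightarrow> nat \<Rightarrow> 'a" where
  "left_inv_coeff f n = fps_X $ n - (\<Sum>i<n. left_inv_coeff f i * (f ^ i) $ n)"

declare left_inv_coeff.simps [simp del]

lemma ex_left_comp_inverse:
  fixes f :: "'a :: comm_ring_1 fps"
  assumes "f $ 0 = 0" "f $ 1 = 1"
  obtains g where "g $ 0 = 0" "g $ 1 = 1" "g oo f = fps_X"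
proof
  define g where "g = Abs_fps (left_inv_coeff f)"
  show "g $ 0 = 0"
    by (simp add: g_def left_inv_coeff.simps[of f 0])
  then show "g $ 1 = 1"
    by (simp add: g_def left_inv_coeff.simps[of f "Suc 0"])
  show "g oo f = fps_X"
  proof (rule fps_ext)
    fix n :: nat
    have *: "{0..n} = insert n {..<n}"
      by auto
    have "(g oo f) $ n = g $ n * (f ^ n) $ n + (\<Sum>i<n. g $ i * (f ^ i) $ n)"
      unfolding fps_compose_nth * by simp
    also have "(f ^ n) $ n = 1"
      using startsby_zero_power_nth_same[OF assms(1), of n] assms(2) by simp
    also have "g $ n = fps_X $ n - (\<Sum>i<n. g $ i * (f ^ i) $ n)"
      by (simp add: g_def left_inv_coeff.simps[of f n])
    finally show "(g oo f) $ n = fps_X $ n"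
      by simp
  qed
qed

lemma ex1_comp_inverse:
  fixes f :: "'a :: idom fps"
  assumes f: "f $ 0 = 0" "f $ 1 = 1"
  shows "\<exists>!g. is_comp_inverse f g"
proof -
  obtain g where g: "g $ 0 = 0" "g $ 1 = 1" "g oo f = fps_X"
    using ex_left_comp_inverse[OF f] .
  obtain h where h: "h $ 0 = 0" "h $ 1 = 1" "h oo g = fps_X"
    using ex_left_comp_inverse[OF g(1,2)] .
  have "h = h oo (g oo f)"
    unfolding g(3) by simp
  also have "\<dots> = (h oo g) oo f"
    using f(1) g(1) by (rule fps_compose_assoc)
  also have "\<dots> = f"
    unfolding h(3) using f(1) by simp
  finally have fg: "f oo g = fps_X"
    using h(3) by simp
  show ?thesis
  proof (rule ex1I)
    show "is_comp_inverse f g"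
      using f g fg by (simp add: is_comp_inverse_def)
  next
    fix g' assume "is_comp_inverse f g'"
    hence g': "g' $ 0 = 0" "f oo g' = fps_X"
      by (simp_all add: is_comp_inverse_def)
    have "g' = (g oo f) oo g'"
      unfolding g(3) using g'(1) by simp
    also have "\<dots> = g oo (f oo g')"
      using g'(1) f(1) by (rule fps_compose_assoc [symmetric])
    also have "\<dots> = g"
      unfolding g'(2) by simp
    finally show "g' = g" .
  qed
qed

lemma alpha_fps_nth:
  "alpha_fps $ 0 = 0" "alpha_fps $ 1 = 1" "n \<ge> 1 \<Longrightarrow> alpha_fps $ (n + 1) = indet n"
  by (auto simp: alpha_fps_def)

lemma beta_fps_comp_inverse: "is_comp_inverse alpha_fps beta_fps"
  unfolding beta_fps_def
  by (rule theI') (intro ex1_comp_inverse alpha_fps_nth)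

lemma beta_fps_nth: "beta_fps $ 0 = 0" "beta_fps $ 1 = 1" "beta_fps $ (n + 1) = b_coeff n"
proof -
  have "(alpha_fps oo beta_fps) $ 1 = (fps_X :: zpoly fps) $ 1"
    using beta_fps_comp_inverse by (simp add: is_comp_inverse_def)
  thus "beta_fps $ 1 = 1"
    using alpha_fps_nth(1,2) by (simp add: fps_compose_nth)
qed (use beta_fps_comp_inverse in \<open>simp_all add: is_comp_inverse_def b_coeff_def\<close>)


definition a_monom :: "nat multiset \<Rightarrow> zpoly" where
  "a_monom lam = (\<Prod>i\<in>#lam. indet i)"

definition b_monom :: "nat multiset \<Rightarrow> zpoly" where
  "b_monom \<mu> = (\<Prod>i\<in>#\<mu>. b_coeff i)"

definition exponents :: "nat multiset \<Rightarrow> (nat \<Rightarrow>\<^sub>0 nat)" where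
  "exponents lam = (\<Sum>i\<in>#lam. Poly_Mapping.single i 1)"

lemma a_monom_eq_single: "a_monom lam = Poly_Mapping.single (exponents lam) 1"
  by (induction lam) (simp_all add: a_monom_def exponents_def indet_def mult_single)

definition C_coeff :: "nat multiset \<Rightarrow> nat multiset \<Rightarrow> int" where
  "C_coeff \<mu> lam = Poly_Mapping.lookup (b_monom \<mu>) (exponents lam)"

definition G_coeff :: "nat \<Rightarrow> nat multiset \<Rightarrow> int" where
  "G_coeff k lam =
     (\<Sum>\<mu>\<in>partitions k. (-1) ^ (k - size \<mu>) * C_coeff \<mu> lam * int (num_perms \<mu>))"

end

theory Submission
  imports Defs
begin

text \<open>
  Both sides of the identity are specialisations of the generating function $v / \beta(v)$.
  Expanding the geometric series $v/\beta(v) = 1/(1 + \sum_n b_n v^n)$ as a sum over compositions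
  and grouping the compositions of \<open>k\<close> by their underlying partition \<open>\<mu>\<close> gives
  $[v^k]\, v/\beta(v) = \sum_\mu (-1)^{l(\mu)} N(\mu)\, b^\mu$
  (\<open>sum_partitions_num_perms\<close>, \<open>composition_sum_inverse\<close>).  So, up to the sign $(-1)^k$,
  \<open>G(\<lambda>)\<close> is the coefficient of $a^\lambda$ in this polynomial.  As $b_n$ is isobaric of weight
  \<open>n\<close> when $a_i$ has weight \<open>i\<close> (\<open>isobaric_b_coeff\<close>), the monomials $a^\lambda$ with
  $|\lambda| = k$ are the only ones that occur (\<open>eval_b_monom\<close>).

  Now specialise $a_i = 1/(i+1)$, which turns $a^\lambda$ into the weight of \<open>\<lambda>\<close> in the formula.
  The series $\alpha$ becomes $\sum_{n \ge 1} u^n/n = -\ln(1-u)$, hence $\beta$ becomes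
  $1 - e^{-v}$ (\<open>eval_beta_fps\<close>), and $v/(1-e^{-v})$ is the generating function of $B_k/k!$ with
  \<open>v\<close> replaced by \<open>-v\<close>.  This substitution accounts for the sign $(-1)^k$.
\<close>

section \<open>Evaluation of polynomials\<close>

definition monom_eval :: "(nat \<Rightarrow> 'a) \<Rightarrow> (nat \<Rightarrow>\<^sub>0 nat) \<Rightarrow> 'a :: comm_ring_1" where
  "monom_eval w m = (\<Prod>i\<in>Poly_Mapping.keys m. w i ^ Poly_Mapping.lookup m i)"

definition poly_eval :: "(nat \<Rightarrow> 'a) \<Rightarrow> zpoly \<Rightarrow> 'a :: comm_ring_1" where
  "poly_eval w p =
     (\<Sum>m\<in>Poly_Mapping.keys p. of_int (Poly_Mapping.lookup p m) * monom_eval w m)"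

lemma monom_eval_superset:
  assumes "finite A" "Poly_Mapping.keys m \<subseteq> A"
  shows "monom_eval w m = (\<Prod>i\<in>A. w i ^ Poly_Mapping.lookup m i)"
  unfolding monom_eval_def using assms
  by (intro prod.mono_neutral_left) (auto simp: in_keys_iff)

lemma poly_eval_superset:
  assumes "finite A" "Poly_Mapping.keys p \<subseteq> A"
  shows "poly_eval w p = (\<Sum>m\<in>A. of_int (Poly_Mapping.lookup p m) * monom_eval w m)"
  unfolding poly_eval_def using assms
  by (intro sum.mono_neutral_left) (auto simp: in_keys_iff)

lemma monom_eval_0 [simp]: "monom_eval w 0 = 1"
  by (simp add: monom_eval_def)

lemma monom_eval_single [simp]: "monom_eval w (Poly_Mapping.single i 1) = w i"
  by (simp add: monom_eval_def)

lemma monom_eval_add: "monom_eval w (m + n) = monom_eval w m * monom_eval w n"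
proof -
  let ?A = "Poly_Mapping.keys m \<union> Poly_Mapping.keys n"
  have "Poly_Mapping.keys (m + n) \<subseteq> ?A"
    by (rule Poly_Mapping.keys_add)
  then show ?thesis
    by (simp add: monom_eval_superset[of ?A] lookup_add power_add prod.distrib)
qed

lemma monom_eval_exponents: "monom_eval w (exponents lam) = (\<Prod>i\<in>#lam. w i)"
proof (induction lam)
  case (add i lam)
  then show ?case
    using monom_eval_single[of w i] by (simp add: exponents_def monom_eval_add)
qed (simp add: exponents_def)

lemma poly_eval_0 [simp]: "poly_eval w 0 = 0"
  by (simp add: poly_eval_def)

lemma poly_eval_frag_of: "poly_eval w (frag_of m) = monom_eval w m"
  by (simp add: poly_eval_def)

lemma poly_eval_1 [simp]: "poly_eval w 1 = 1"
  by (simp add: poly_eval_def)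

lemma poly_eval_indet: "poly_eval w (indet n) = w n"
  unfolding indet_def poly_eval_frag_of monom_eval_single ..

lemma poly_eval_add: "poly_eval w (p + q) = poly_eval w p + poly_eval w q"
proof -
  let ?A = "Poly_Mapping.keys p \<union> Poly_Mapping.keys q"
  have "Poly_Mapping.keys (p + q) \<subseteq> ?A"
    by (rule Poly_Mapping.keys_add)
  then show ?thesis
    by (simp add: poly_eval_superset[of ?A] lookup_add distrib_right sum.distrib)
qed

lemma poly_eval_diff: "poly_eval w (p - q) = poly_eval w p - poly_eval w q"
  using poly_eval_add[of w "p - q" q] by (simp add: algebra_simps)

lemma poly_eval_sum: "poly_eval w (\<Sum>i\<in>A. f i) = (\<Sum>i\<in>A. poly_eval w (f i))"
  by (induction A rule: infinite_finite_induct) (simp_all add: poly_eval_add)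

text \<open>
  A polynomial is an integer combination of monomials, i.e. an element of the free abelian group on
  the exponent vectors, and both sides are additive in each factor.  So it is enough to compare
  them on monomials.
\<close>

lemma poly_eval_mult: "poly_eval w (p * q) = poly_eval w p * poly_eval w q"
proof (induction p rule: frag_induction[OF subset_UNIV])
  case (2 m)
  show ?case
  proof (induction q rule: frag_induction[OF subset_UNIV])
    case (2 n)
    have "frag_of m * frag_of n = frag_of (m + n)"
      by (simp add: mult_single)
    then show ?case
      by (simp only: poly_eval_frag_of monom_eval_add)
  qed (simp_all add: poly_eval_diff right_diff_distrib)
qed (simp_all add: poly_eval_diff left_diff_distrib)

lemma poly_eval_prod_mset: "poly_eval w (\<Prod>i\<in>#\<mu>. f i) = (\<Prod>i\<in>#\<mu>. poly_eval w (f i))"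
  by (induction \<mu>) (simp_all add: poly_eval_mult)

definition fps_eval :: "(nat \<Rightarrow> 'a) \<Rightarrow> zpoly fps \<Rightarrow> 'a :: comm_ring_1 fps" where
  "fps_eval w f = Abs_fps (\<lambda>n. poly_eval w (f $ n))"

lemma fps_eval_nth [simp]: "fps_eval w f $ n = poly_eval w (f $ n)"
  by (simp add: fps_eval_def)

lemma fps_eval_mult: "fps_eval w (f * g) = fps_eval w f * fps_eval w g"
  by (rule fps_ext) (simp add: fps_mult_nth poly_eval_sum poly_eval_mult)

lemma fps_eval_1 [simp]: "fps_eval w 1 = 1"
  by (rule fps_ext) simp

lemma fps_eval_X [simp]: "fps_eval w fps_X = fps_X"
  by (rule fps_ext) simp

lemma fps_eval_power: "fps_eval w (f ^ n) = fps_eval w f ^ n"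
  by (induction n) (simp_all add: fps_eval_mult)

lemma fps_eval_compose: "fps_eval w (f oo g) = fps_eval w f oo fps_eval w g"
  by (rule fps_ext)
    (simp add: fps_compose_nth poly_eval_sum poly_eval_mult flip: fps_eval_power)


section \<open>Isobaric polynomials\<close>

text \<open>
  Encoding the weight through partitions, rather than as a weighted degree, also rules out the
  spurious indeterminate of index \<open>0\<close>.
\<close>

definition isobaric :: "nat \<Rightarrow> zpoly \<Rightarrow> bool" where
  "isobaric n p \<longleftrightarrow> Poly_Mapping.keys p \<subseteq> exponents ` partitions n"

lemma exponents_add: "exponents (lam + \<mu>) = exponents lam + exponents \<mu>"
  by (simp add: exponents_def)

lemma lookup_exponents: "Poly_Mapping.lookup (exponents lam) i = count lam i"
  by (induction lam) (auto simp: exponents_def lookup_add lookup_single when_def)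

lemma inj_exponents: "inj exponents"
  by (rule injI) (metis lookup_exponents multiset_eqI)

lemma isobaric_0 [simp]: "isobaric n 0"
  by (simp add: isobaric_def)

lemma isobaric_1 [simp]: "isobaric 0 1"
  unfolding isobaric_def by (auto simp: exponents_def partitions_def intro!: image_eqI[of _ _ "{#}"])

lemma isobaric_indet:
  assumes "n \<ge> 1"
  shows "isobaric n (indet n)"
  using assms unfolding isobaric_def indet_def
  by (auto simp: exponents_def partitions_def intro!: image_eqI[of _ _ "{#n#}"])

lemma isobaric_diff: "isobaric n p \<Longrightarrow> isobaric n q \<Longrightarrow> isobaric n (p - q)"
  unfolding isobaric_def using keys_diff[of p q] by blast

lemma isobaric_sum: "(\<And>i. i \<in> A \<Longrightarrow> isobaric n (f i)) \<Longrightarrow> isobaric n (\<Sum>i\<in>A. f i)"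
  unfolding isobaric_def using keys_sum[of f A] by blast

lemma isobaric_mult:
  assumes "isobaric m p" "isobaric n q"
  shows "isobaric (m + n) (p * q)"
  unfolding isobaric_def
proof
  fix x assume "x \<in> Poly_Mapping.keys (p * q)"
  then obtain y z where "x = y + z" "y \<in> Poly_Mapping.keys p" "z \<in> Poly_Mapping.keys q"
    using keys_mult[of p q] by blast
  with assms obtain lam \<mu> where
    "x = exponents (lam + \<mu>)" "lam \<in> partitions m" "\<mu> \<in> partitions n"
    unfolding isobaric_def exponents_add by blast
  moreover from this have "lam + \<mu> \<in> partitions (m + n)"
    by (auto simp: partitions_def)
  ultimately show "x \<in> exponents ` partitions (m + n)"
    by blast
qed

text \<open>
  In $\alpha(u)$ the coefficient of $u^{j+1}$ has weight \<open>j\<close>, one less than the exponent; each of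
  the \<open>i\<close> factors of $\alpha^i$ contributes one such unit of defect.
\<close>

lemma isobaric_alpha_power:
  "n < i \<Longrightarrow> (alpha_fps ^ i) $ n = 0"
  "i \<le> n \<Longrightarrow> isobaric (n - i) ((alpha_fps ^ i) $ n)"
proof -
  show zero: "n < i \<Longrightarrow> (alpha_fps ^ i) $ n = 0" for i n
    using startsby_zero_power_prefix[OF alpha_fps_nth(1), of i] by simp
  have alpha: "isobaric j (alpha_fps $ Suc j)" for j
    using alpha_fps_nth(2) alpha_fps_nth(3)[of j] isobaric_indet[of j] by (cases "j = 0") auto
  show "i \<le> n \<Longrightarrow> isobaric (n - i) ((alpha_fps ^ i) $ n)"
  proof (induction i arbitrary: n)
    case 0
    then show ?case
      by (cases n) simp_all
  next
    case (Suc i)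
    have "isobaric (n - Suc i) (alpha_fps $ j * (alpha_fps ^ i) $ (n - j))" if "j \<in> {0..n}" for j
    proof (cases "j = 0 \<or> n - j < i")
      case True
      then show ?thesis
        using alpha_fps_nth(1) zero by auto
    next
      case False
      then obtain j' where "j = Suc j'"
        by (cases j) auto
      with False that Suc.prems show ?thesis
        using isobaric_mult[OF alpha[of j'] Suc.IH[of "n - j"]] by simp
    qed
    then show ?case
      unfolding power_Suc fps_mult_nth by (rule isobaric_sum)
  qed
qed

text \<open>
  Comparing coefficients in $\beta(\alpha(u)) = u$ expresses $b_n$ through $b_j$ with \<open>j < n\<close>
  and coefficients of powers of $\alpha$, all of which have the right weight.
\<close>

lemma isobaric_b_coeff: "isobaric n (b_coeff n)"
proof (induction n rule: less_induct)
  case (less n)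
  have summand: "isobaric n (beta_fps $ i * (alpha_fps ^ i) $ Suc n)" if "i < Suc n" for i
  proof (cases i)
    case 0
    then show ?thesis by (simp add: beta_fps_nth(1))
  next
    case (Suc j)
    with that have "isobaric j (beta_fps $ i)"
      using less.IH[of j] by (simp add: b_coeff_def)
    from isobaric_mult[OF this isobaric_alpha_power(2)[of i "Suc n"]] that Suc show ?thesis
      by simp
  qed
  have "(beta_fps oo alpha_fps) $ Suc n = (fps_X :: zpoly fps) $ Suc n"
    using beta_fps_comp_inverse by (simp add: is_comp_inverse_def)
  moreover have "{0..Suc n} = insert (Suc n) {..<Suc n}"
    by auto
  moreover have "(alpha_fps ^ Suc n) $ Suc n = 1"
    using startsby_zero_power_nth_same[OF alpha_fps_nth(1), of "Suc n"] alpha_fps_nth(2) by simp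
  ultimately have "b_coeff n =
      (fps_X :: zpoly fps) $ Suc n - (\<Sum>i<Suc n. beta_fps $ i * (alpha_fps ^ i) $ Suc n)"
    by (simp add: fps_compose_nth b_coeff_def algebra_simps del: power_Suc sum.lessThan_Suc)
  moreover have "isobaric n ((fps_X :: zpoly fps) $ Suc n)"
    by (cases "n = 0") simp_all
  ultimately show ?case
    using summand by (simp only:) (intro isobaric_diff isobaric_sum, simp_all)
qed

lemma isobaric_b_monom: "isobaric (sum_mset \<mu>) (b_monom \<mu>)"
  by (induction \<mu>) (auto simp: b_monom_def intro!: isobaric_mult isobaric_b_coeff)

text \<open>
  By isobarity, the numbers \<open>C_coeff \<mu> lam\<close> with \<open>lam\<close> a partition of \<open>k\<close> are all the
  coefficients of $b^\mu$, so they determine its value under every specialisation.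
\<close>

lemma eval_b_monom:
  assumes "\<mu> \<in> partitions k"
  shows "(\<Prod>i\<in>#\<mu>. poly_eval w (b_coeff i)) =
    (\<Sum>lam\<in>partitions k. of_int (C_coeff \<mu> lam) * (\<Prod>i\<in>#lam. w i))"
proof -
  have "Poly_Mapping.keys (b_monom \<mu>) \<subseteq> exponents ` partitions k"
    using isobaric_b_monom[of \<mu>] assms by (simp add: isobaric_def partitions_def)
  then have "poly_eval w (b_monom \<mu>) =
      (\<Sum>m\<in>exponents ` partitions k. of_int (Poly_Mapping.lookup (b_monom \<mu>) m) * monom_eval w m)"
    by (intro poly_eval_superset finite_imageI finite_partitions)
  also have "\<dots> = (\<Sum>lam\<in>partitions k. of_int (C_coeff \<mu> lam) * (\<Prod>i\<in>#lam. w i))"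
    by (subst sum.reindex)
      (auto intro: inj_on_subset[OF inj_exponents] simp: C_coeff_def monom_eval_exponents)
  finally show ?thesis
    by (simp add: b_monom_def poly_eval_prod_mset)
qed


section \<open>Compositions and the geometric series\<close>

definition compositions :: "nat \<Rightarrow> nat list set" where
  "compositions k = {xs. 0 \<notin> set xs \<and> sum_list xs = k}"

lemma compositions_eq_UN: "compositions k = (\<Union>\<mu>\<in>partitions k. permutations_of_multiset \<mu>)"
  by (auto simp: compositions_def partitions_def permutations_of_multiset_def sum_mset_sum_list)

lemma finite_compositions: "finite (compositions k)"
  unfolding compositions_eq_UN by (simp add: finite_partitions)

lemma sum_partitions_num_perms:
  fixes x :: "nat \<Rightarrow> 'a :: comm_ring_1"
  shows "(\<Sum>\<mu>\<in>partitions k. of_nat (num_perms \<mu>) * (\<Prod>i\<in>#\<mu>. x i)) =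
    (\<Sum>xs\<in>compositions k. prod_list (map x xs))"
proof -
  have orderings: "(\<Sum>xs\<in>permutations_of_multiset \<mu>. prod_list (map x xs)) =
      of_nat (num_perms \<mu>) * (\<Prod>i\<in>#\<mu>. x i)" for \<mu>
  proof -
    have "(\<Sum>xs\<in>permutations_of_multiset \<mu>. prod_list (map x xs)) =
        (\<Sum>xs\<in>permutations_of_multiset \<mu>. \<Prod>i\<in>#\<mu>. x i)"
      by (rule sum.cong) (auto simp: permutations_of_multiset_def simp flip: prod_mset_prod_list)
    then show ?thesis
      by (simp add: num_perms_def)
  qed
  have "(\<Sum>xs\<in>compositions k. prod_list (map x xs)) =
      (\<Sum>\<mu>\<in>partitions k. \<Sum>xs\<in>permutations_of_multiset \<mu>. prod_list (map x xs))"
    unfolding compositions_eq_UN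
    by (rule sum.UNION_disjoint) (auto simp: finite_partitions dest: permutations_of_multisetD)
  then show ?thesis
    by (simp add: orderings)
qed

lemma compositions_0: "compositions 0 = {[]}"
proof -
  have "xs = []" if "0 \<notin> set xs" "sum_list xs = 0" for xs :: "nat list"
    using that by (cases xs) auto
  then show ?thesis
    by (auto simp: compositions_def)
qed

lemma compositions_rec:
  assumes "k > 0"
  shows "compositions k = (\<Union>j\<in>{1..k}. (#) j ` compositions (k - j))"
proof (intro equalityI subsetI)
  fix xs assume xs: "xs \<in> compositions k"
  then obtain j ys where "xs = j # ys"
    using assms by (cases xs) (auto simp: compositions_def)
  with xs show "xs \<in> (\<Union>j\<in>{1..k}. (#) j ` compositions (k - j))"
    by (auto simp: compositions_def intro!: bexI[of _ j])
qed (use assms in \<open>auto simp: compositions_def\<close>)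

text \<open>
  Splitting off the first part of a composition is the recursion for the coefficients of the
  inverse power series.
\<close>

lemma composition_sum_inverse:
  fixes x :: "nat \<Rightarrow> 'a :: comm_ring_1"
  assumes "x 0 = 1"
  shows "Abs_fps x * Abs_fps (\<lambda>k. \<Sum>xs\<in>compositions k. prod_list (map (\<lambda>i. - x i) xs)) = 1"
    (is "_ * Abs_fps ?c = 1")
proof (rule fps_ext)
  fix k
  show "(Abs_fps x * Abs_fps ?c) $ k = 1 $ k"
  proof (cases "k = 0")
    case True
    then show ?thesis by (simp add: compositions_0 assms)
  next
    case False
    then have k: "k > 0" by simp
    have "?c k = (\<Sum>j\<in>{1..k}. \<Sum>xs\<in>(#) j ` compositions (k - j). prod_list (map (\<lambda>i. - x i) xs))"
      unfolding compositions_rec[OF k]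
      by (intro sum.UNION_disjoint) (auto simp: finite_compositions)
    also have "\<dots> = (\<Sum>j\<in>{1..k}. - x j * ?c (k - j))"
      by (intro sum.cong refl, subst sum.reindex) (auto simp: sum_distrib_left)
    finally have "?c k = - (\<Sum>j\<in>{1..k}. x j * ?c (k - j))"
      by (simp add: sum_negf)
    moreover have "{0..k} = insert 0 {1..k}"
      by auto
    ultimately show ?thesis
      using False assms by (simp add: fps_mult_nth)
  qed
qed


section \<open>The logarithmic specialisation\<close>

abbreviation log_weight :: "nat \<Rightarrow> rat" where
  "log_weight i \<equiv> 1 / of_nat (i + 1)"

lemma compose_minus_X_nth:
  fixes f :: "'a :: comm_ring_1 fps"
  shows "(f oo - fps_X) $ n = (-1) ^ n * f $ n"
  using fps_compose_linear[of f "-1"] by (simp flip: fps_const_neg)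

lemma eval_alpha_fps: "fps_eval log_weight alpha_fps = fps_ln (-1) oo - fps_X"
proof (rule fps_ext)
  fix n
  show "fps_eval log_weight alpha_fps $ n = (fps_ln (-1) oo - fps_X) $ n"
    by (cases n; cases "n = 1")
      (auto simp: alpha_fps_def compose_minus_X_nth fps_ln_nth poly_eval_indet of_nat_diff
        poly_eval_add simp flip: power_add power_mult_distrib)
qed

text \<open>
  Being the compositional inverse survives specialisation, so it suffices to see that
  $1 - e^{-v}$ is a right inverse of $-\ln(1-u)$: a left and a right inverse coincide.
\<close>

lemma eval_beta_fps: "fps_eval log_weight beta_fps = 1 - fps_exp (-1)"
proof -
  let ?A = "fps_eval log_weight alpha_fps" and ?B = "fps_eval log_weight beta_fps"
  let ?E = "1 - fps_exp (-1) :: rat fps"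
  have "?A oo ?E = fps_ln (-1) oo (- fps_X oo ?E)"
    unfolding eval_alpha_fps by (rule fps_compose_assoc[symmetric]) simp_all
  also have "- fps_X oo ?E = fps_exp (-1) - 1"
    by (simp add: fps_compose_uminus)
  also have "fps_ln (-1) oo (fps_exp (-1) - 1) = (fps_X :: rat fps)"
    by (simp add: fps_ln_fps_exp_inv fps_inv)
  finally have right: "?A oo ?E = fps_X" .
  have "beta_fps oo alpha_fps = fps_X"
    using beta_fps_comp_inverse by (simp add: is_comp_inverse_def)
  then have left: "?B oo ?A = fps_X"
    by (simp flip: fps_eval_compose)
  have "?B = ?B oo (?A oo ?E)"
    unfolding right by simp
  also have "\<dots> = (?B oo ?A) oo ?E"
    using alpha_fps_nth(1) by (intro fps_compose_assoc) simp_all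
  also have "\<dots> = ?E"
    unfolding left by simp
  finally show ?thesis .
qed

lemma bernoulli_egf_minus:
  "(Abs_fps (\<lambda>n. bernoulli_num n / fact n) oo - fps_X) * (1 - fps_exp (-1)) = fps_X"
proof -
  let ?B = "Abs_fps (\<lambda>n. bernoulli_num n / fact n)"
  have "(?B oo - fps_X) * ((fps_exp 1 - 1) oo - fps_X) = fps_X oo - fps_X"
    unfolding bernoulli_num_egf[symmetric] by (rule fps_compose_mult_distrib[symmetric]) simp
  then have "(?B oo - fps_X) * (fps_exp (-1) - 1) = - fps_X"
    by (simp add: fps_compose_sub_distrib)
  then show ?thesis
    by (simp add: algebra_simps)
qed

lemma composition_sum_bernoulli:
  "(\<Sum>xs\<in>compositions k. prod_list (map (\<lambda>i. - poly_eval log_weight (b_coeff i)) xs)) =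
    (-1) ^ k * (bernoulli_num k / fact k)"
proof -
  let ?x = "\<lambda>i. poly_eval log_weight (b_coeff i)"
  let ?C = "Abs_fps (\<lambda>k. \<Sum>xs\<in>compositions k. prod_list (map (\<lambda>i. - ?x i) xs))"
  let ?B = "Abs_fps (\<lambda>n. bernoulli_num n / fact n) oo - fps_X"
  let ?E = "1 - fps_exp (-1) :: rat fps"
  have "?x 0 = 1"
    using beta_fps_nth(2) by (simp add: b_coeff_def)
  then have inverse: "Abs_fps ?x * ?C = 1"
    by (rule composition_sum_inverse)
  have "fps_X * Abs_fps ?x = fps_eval log_weight beta_fps"
    by (rule fps_ext) (simp add: b_coeff_def beta_fps_nth(1))
  then have E: "?E = fps_X * Abs_fps ?x"
    by (simp only: eval_beta_fps)
  have "?C * ?E = ?B * ?E"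
    unfolding bernoulli_egf_minus unfolding E using inverse by (simp add: mult_ac)
  moreover have "?E \<noteq> 0"
    using bernoulli_egf_minus by auto
  ultimately have "?C = ?B"
    by simp
  then have "?C $ k = ?B $ k"
    by simp
  then show ?thesis
    by (simp add: compose_minus_X_nth)
qed

theorem mainTheorem5:
  fixes k :: nat
  assumes "k \<ge> 1"
  shows "bernoulli_num k =
    fact k * (\<Sum>lam\<in>partitions k. of_int (G_coeff k lam) / (\<Prod>i\<in>#lam. of_nat (i + 1)))"
proof -
  let ?x = "\<lambda>i. poly_eval log_weight (b_coeff i)"
  have weight: "(\<Prod>i\<in>#lam. log_weight i) = 1 / (\<Prod>i\<in>#lam. of_nat (i + 1))" for lam
    by (induction lam) simp_all
  have sign: "(-1) ^ (k - size \<mu>) * (\<Prod>i\<in>#\<mu>. ?x i) = (-1) ^ k * (\<Prod>i\<in>#\<mu>. - ?x i)"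
    if "\<mu> \<in> partitions k" for \<mu>
  proof -
    have "size \<mu> \<le> k"
      using that size_le_sum_mset[of \<mu>] by (auto simp: partitions_def)
    then have "(-1) ^ k = (-1 :: rat) ^ (k - size \<mu>) * (-1) ^ size \<mu>"
      by (simp flip: power_add)
    moreover have "(\<Prod>i\<in>#\<mu>. - ?x i) = (-1) ^ size \<mu> * (\<Prod>i\<in>#\<mu>. ?x i)"
      by (induction \<mu>) simp_all
    ultimately show ?thesis
      by (simp flip: power_mult_distrib)
  qed
  have "(\<Sum>lam\<in>partitions k. of_int (G_coeff k lam) / (\<Prod>i\<in>#lam. of_nat (i + 1))) =
      (\<Sum>lam\<in>partitions k. \<Sum>\<mu>\<in>partitions k. (-1) ^ (k - size \<mu>) * of_nat (num_perms \<mu>) *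
        (of_int (C_coeff \<mu> lam) * (\<Prod>i\<in>#lam. log_weight i)))"
    unfolding weight by (simp add: G_coeff_def sum_divide_distrib mult_ac)
  also have "\<dots> = (\<Sum>\<mu>\<in>partitions k. (-1) ^ (k - size \<mu>) * of_nat (num_perms \<mu>) *
        (\<Prod>i\<in>#\<mu>. ?x i))"
    by (subst sum.swap) (simp add: eval_b_monom sum_distrib_left)
  also have "\<dots> = (\<Sum>\<mu>\<in>partitions k. (-1) ^ k * (of_nat (num_perms \<mu>) * (\<Prod>i\<in>#\<mu>. - ?x i)))"
    using sign by (intro sum.cong refl) (simp add: mult_ac)
  also have "\<dots> = (-1) ^ k * (\<Sum>xs\<in>compositions k. prod_list (map (\<lambda>i. - ?x i) xs))"
    unfolding sum_distrib_left[symmetric] sum_partitions_num_perms ..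
  also have "\<dots> = bernoulli_num k / fact k"
    unfolding composition_sum_bernoulli by (simp flip: power_mult_distrib)
  finally show ?thesis
    by simp
qed

end
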